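(* Let $\widetilde g$ be the kernel ridge regression estimator $$\widetilde g=\operatorname*{arg\,min}_{g\in\mathcal H_K}\Big\{\frac1n\sum_{i=1}^n (Y_i-g(X_i))^2+\lambda\|g\|_K^2\Big\}$$ computed from the fixed-design data described in the context. Assume $K$ is symmetric and positive semi-definite. Then for any $\lambda>0$, $$\mathcal R(\widetilde g-f^* )\ \le\ \inf_{f\in\mathcal H_K}\Big\{\mathcal R(f-f^* )+\lambda\|f\|_K^2\Big\}+\frac{\sigma^2}{n}\sum_{i=1}^n\Big(\frac{\widehat\mu_i}{\widehat\mu_i+\lambda}\Big)^2 .$$
   Context: Model and fixed design: $\mathcal X\subseteq\mathbb R^d$, the points $X_1,\dots,X_n\in\mathcal X$ are deterministic, $f^*:\mathcal X\to\mathbb R$ is the regression function, and $Y_i=f^*(X_i)+\epsilon_i$, where $\epsilon_1,\dots,\epsilon_n$ are independent with $\mathbb E[\epsilon_i]=0$ and $\mathbb E[\epsilon_i^2]=\sigma^2$. Kernel: $K:\mathcal X\times\mathcal X\to\mathbb R$ is a kernel function; positive semi-definite means every matrix $(K(x_i,x_j))_{i,j}$ for finitely many points is positive semi-definite. $\mathcal H_K$ is the reproducing kernel Hilbert space of $K$, with norm $\|\cdot\|_K$. The kernel matrix $\mathbb K\in\mathbb R^{n\times n}$ has entries $\mathbb K_{ij}=n^{-1}K(X_i,X_j)$ and eigenvalues $\widehat\mu_1\ge\cdots\ge\widehat\mu_n\ge0$. Risk: for a (possibly data-dependent) function $f:\mathcal X\to\mathbb R$, $\mathcal R(f-f^* )=\frac1n\sum_{i=1}^n\mathbb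 E[(f(X_i)-f^*(X_i))^2]$; the expectation is over the noise. *)

theory Defs
  imports
    "HOL-Probability.Probability"
    "Jordan_Normal_Form.Char_Poly"
begin

text \<open>
  A real function on a set \<open>D\<close> is represented by its extension by zero to the whole type. Thus the
  elements of a function space on \<open>D\<close> are determined by their values on \<open>D\<close>, and the vector space
  operations are the pointwise ones. Finite families are indexed by \<open>{..<n}\<close> instead of
  \<open>{1..n}\<close>.
\<close>

definition kernel_symmetric :: "'a set \<Rightarrow> ('a \<Rightarrow> 'a \<Rightarrow> real) \<Rightarrow> bool" where
  "kernel_symmetric D K \<longleftrightarrow> (\<forall>s\<in>D. \<forall>t\<in>D. K s t = K t s)"

definition kernel_psd :: "'a set \<Rightarrow> ('a \<Rightarrow> 'a \<Rightarrow> real) \<Rightarrow> bool" where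
  "kernel_psd D K \<longleftrightarrow>
     (\<forall>(m::nat) (z :: nat \<Rightarrow> 'a) (c :: nat \<Rightarrow> real). (\<forall>i<m. z i \<in> D) \<longrightarrow>
        0 \<le> (\<Sum>i<m. \<Sum>j<m. c i * c j * K (z i) (z j)))"

definition function_space_on :: "'a set \<Rightarrow> ('a \<Rightarrow> real) set \<Rightarrow> bool" where
  "function_space_on D H \<longleftrightarrow>
     (\<forall>f\<in>H. \<forall>t. t \<notin> D \<longrightarrow> f t = 0) \<and>
     (\<lambda>t. 0) \<in> H \<and>
     (\<forall>f\<in>H. \<forall>g\<in>H. (\<lambda>t. f t + g t) \<in> H) \<and>
     (\<forall>c. \<forall>f\<in>H. (\<lambda>t. c * f t) \<in> H)"

definition inner_product_on ::
  "('a \<Rightarrow> real) set \<Rightarrow> (('a \<Rightarrow> real) \<Rightarrow> ('a \<Rightarrow> real) \<Rightarrow> real) \<Rightarrow> bool" where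
  "inner_product_on H ip \<longleftrightarrow>
     (\<forall>f\<in>H. \<forall>g\<in>H. ip f g = ip g f) \<and>
     (\<forall>f\<in>H. \<forall>g\<in>H. \<forall>h\<in>H. ip (\<lambda>t. f t + g t) h = ip f h + ip g h) \<and>
     (\<forall>c. \<forall>f\<in>H. \<forall>g\<in>H. ip (\<lambda>t. c * f t) g = c * ip f g) \<and>
     (\<forall>f\<in>H. f \<noteq> (\<lambda>t. 0) \<longrightarrow> 0 < ip f f)"

definition ip_norm :: "(('a \<Rightarrow> real) \<Rightarrow> ('a \<Rightarrow> real) \<Rightarrow> real) \<Rightarrow> ('a \<Rightarrow> real) \<Rightarrow> real" where
  "ip_norm ip f = sqrt (ip f f)"

definition ip_complete ::
  "('a \<Rightarrow> real) set \<Rightarrow> (('a \<Rightarrow> real) \<Rightarrow> ('a \<Rightarrow> real) \<Rightarrow> real) \<Rightarrow> bool" where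
  "ip_complete H ip \<longleftrightarrow>
     (\<forall>u :: nat \<Rightarrow> 'a \<Rightarrow> real.
        (\<forall>k. u k \<in> H) \<and>
        (\<forall>e>0. \<exists>N. \<forall>k\<ge>N. \<forall>l\<ge>N. ip_norm ip (\<lambda>t. u k t - u l t) < e) \<longrightarrow>
        (\<exists>f\<in>H. (\<lambda>k. ip_norm ip (\<lambda>t. u k t - f t)) \<longlonglongrightarrow> 0))"

definition kernel_section :: "'a set \<Rightarrow> ('a \<Rightarrow> 'a \<Rightarrow> real) \<Rightarrow> 'a \<Rightarrow> 'a \<Rightarrow> real" where
  "kernel_section D K s = (\<lambda>t. if t \<in> D then K s t else 0)"

text \<open>
  \<open>is_rkhs D K H ip\<close>: the function space \<open>H\<close> with inner product \<open>ip\<close> is the reproducing kernel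
  Hilbert space of \<open>K\<close> on \<open>D\<close>. For a symmetric positive semi-definite \<open>K\<close>, such an \<open>H\<close> exists and
  is unique, as is \<open>ip\<close> on \<open>H\<close> (Moore-Aronszajn).
\<close>

definition is_rkhs ::
  "'a set \<Rightarrow> ('a \<Rightarrow> 'a \<Rightarrow> real) \<Rightarrow> ('a \<Rightarrow> real) set \<Rightarrow>
   (('a \<Rightarrow> real) \<Rightarrow> ('a \<Rightarrow> real) \<Rightarrow> real) \<Rightarrow> bool" where
  "is_rkhs D K H ip \<longleftrightarrow>
     function_space_on D H \<and> inner_product_on H ip \<and> ip_complete H ip \<and>
     (\<forall>s\<in>D. kernel_section D K s \<in> H) \<and>
     (\<forall>f\<in>H. \<forall>s\<in>D. ip f (kernel_section D K s) = f s)"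

definition kernel_matrix :: "nat \<Rightarrow> (nat \<Rightarrow> 'a) \<Rightarrow> ('a \<Rightarrow> 'a \<Rightarrow> real) \<Rightarrow> real mat" where
  "kernel_matrix n x K = mat n n (\<lambda>(i, j). K (x i) (x j) / real n)"

text \<open>
  The real eigenvalues in nonincreasing order, repeated according to algebraic multiplicity. The
  list has length \<open>n\<close> for a symmetric \<open>n \<times> n\<close> matrix, whose characteristic polynomial splits over
  the reals.
\<close>

definition ordered_eigenvalues :: "real mat \<Rightarrow> real list" where
  "ordered_eigenvalues A = rev (sorted_list_of_multiset (proots (char_poly A)))"

definition risk :: "'w measure \<Rightarrow> nat \<Rightarrow> (nat \<Rightarrow> 'a) \<Rightarrow> ('w \<Rightarrow> 'a \<Rightarrow> real) \<Rightarrow> real" where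
  "risk M n x h = (\<Sum>i<n. \<integral>\<omega>. (h \<omega> (x i))\<^sup>2 \<partial>M) / real n"

definition krr_objective ::
  "(('a \<Rightarrow> real) \<Rightarrow> ('a \<Rightarrow> real) \<Rightarrow> real) \<Rightarrow> nat \<Rightarrow> (nat \<Rightarrow> 'a) \<Rightarrow> real \<Rightarrow>
   (nat \<Rightarrow> real) \<Rightarrow> ('a \<Rightarrow> real) \<Rightarrow> real" where
  "krr_objective ip n x lam y g =
     (\<Sum>i<n. (y i - g (x i))\<^sup>2) / real n + lam * (ip_norm ip g)\<^sup>2"

definition krr ::
  "('a \<Rightarrow> real) set \<Rightarrow> (('a \<Rightarrow> real) \<Rightarrow> ('a \<Rightarrow> real) \<Rightarrow> real) \<Rightarrow> nat \<Rightarrow> (nat \<Rightarrow> 'a) \<Rightarrow>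
   real \<Rightarrow> (nat \<Rightarrow> real) \<Rightarrow> 'a \<Rightarrow> real" where
  "krr H ip n x lam y = arg_min (krr_objective ip n x lam y) (\<lambda>g. g \<in> H)"

end

theory Submission
  imports Defs
begin

text \<open>
  The whole argument takes place at the design points. Let \<open>A\<close> be the kernel matrix. By the
  reproducing property the ridge estimator is a combination of the kernel sections at the design
  points, and its vector of fitted values is \<open>B y\<close> with \<open>B = A (A + \<lambda>)\<inverse>\<close>
  (\<open>krr_is_spectral_filter\<close>). The fitted values are thus linear in the data \<open>y = f* + \<epsilon>\<close>, so that
  \<open>B y - f* = (B f* - f*) + B \<epsilon>\<close>, and since the noise is centred and uncorrelated with variance
  \<open>\<sigma>\<^sup>2\<close>, the risk is exactly
  \<open>\<parallel>B f* - f*\<parallel>\<^sup>2 / n + \<sigma>\<^sup>2 / n * (sum of the squared entries of B)\<close>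
  (\<open>expectation_square_affine_noise\<close>).

  The bias term involves no computation with \<open>B\<close>. The vector \<open>B f*\<close> consists of the fitted values of
  the ridge estimator for the noiseless data \<open>f*\<close>, and this estimator minimises over \<open>\<H>\<close> the very
  expression whose infimum stands in the bound; its own value there is at least
  \<open>\<parallel>B f* - f*\<parallel>\<^sup>2 / n\<close>.

  For the variance term, \<open>A\<close> is diagonalised by an orthonormal basis, in which \<open>B\<close> is diagonal with
  entries \<open>\<mu> / (\<mu> + \<lambda>)\<close>, and the sum of the squared entries of a matrix does not change under an
  orthogonal change of basis (\<open>sum_squares_spectral_filter\<close>). The spectral theorem for real symmetric
  matrices (\<open>real_symmetric_diagonalizable\<close>) also identifies the diagonal entries with the roots of
  the characteristic polynomial, by which the ordered eigenvalues are defined.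
\<close>

section \<open>Orthogonal diagonalisation of real symmetric matrices\<close>

text \<open>
  The Hermitian form \<open>q\<close> of \<open>a\<close> at the eigenvector is its own conjugate, and it equals \<open>z\<close> times the
  positive number \<open>\<parallel>v\<parallel>\<^sup>2\<close>.
\<close>

lemma eigenvalue_of_real_symmetric_is_real:
  fixes a :: "nat \<Rightarrow> nat \<Rightarrow> real" and v :: "nat \<Rightarrow> complex" and z :: complex
  assumes sym: "\<And>i j. i < n \<Longrightarrow> j < n \<Longrightarrow> a i j = a j i"
    and ev: "\<And>i. i < n \<Longrightarrow> (\<Sum>j<n. of_real (a i j) * v j) = z * v i"
    and nz: "\<exists>i<n. v i \<noteq> 0"
  shows "z \<in> \<real>"
proof -
  define N where "N = (\<Sum>i<n. (cmod (v i))\<^sup>2)"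
  define q where "q = (\<Sum>i<n. \<Sum>j<n. of_real (a i j) * v j * cnj (v i))"
  obtain i0 where i0: "i0 < n" "v i0 \<noteq> 0" using nz by blast
  have "0 < N" unfolding N_def
    by (rule sum_pos2[of _ i0]) (use i0 in auto)
  have "q = (\<Sum>i<n. z * v i * cnj (v i))"
    unfolding q_def by (rule sum.cong) (simp_all add: ev[symmetric] sum_distrib_right)
  also have "\<dots> = z * of_real N"
    by (simp only: N_def of_real_sum sum_distrib_left mult.assoc complex_norm_square)
  finally have qN: "q = z * of_real N" .
  have "cnj q = (\<Sum>i<n. \<Sum>j<n. of_real (a i j) * cnj (v j) * v i)"
    by (simp add: q_def)
  also have "\<dots> = (\<Sum>j<n. \<Sum>i<n. of_real (a i j) * cnj (v j) * v i)"
    by (rule sum.swap)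
  also have "\<dots> = q"
    unfolding q_def by (intro sum.cong refl) (simp add: sym)
  finally have "cnj z * of_real N = z * of_real N"
    using qN by (metis complex_cnj_complex_of_real complex_cnj_mult)
  then show ?thesis using \<open>0 < N\<close> by (simp add: Reals_cnj_iff)
qed

text \<open>
  The characteristic polynomial has a complex root, which must be real. As the matrix is real too,
  the real and the imaginary part of a complex eigenvector satisfy the eigenvector equation
  separately, and at least one of them does not vanish.
\<close>

lemma real_symmetric_has_unit_eigenvector:
  fixes A :: "real mat"
  assumes A: "A \<in> carrier_mat n n" and sym: "transpose_mat A = A" and n: "0 < n"
  shows "\<exists>v e. v \<in> carrier_vec n \<and> A *\<^sub>v v = e \<cdot>\<^sub>v v \<and> (\<Sum>i<n. (v $ i)\<^sup>2) = 1"
proof -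
  define B where "B = map_mat complex_of_real A"
  have B: "B \<in> carrier_mat n n" using A by (simp add: B_def)
  have "\<not> constant (poly (char_poly B))"
    using degree_monic_char_poly[OF B] n by (simp add: constant_degree)
  then obtain z where "poly (char_poly B) z = 0"
    using fundamental_theorem_of_algebra by blast
  then obtain w where w: "w \<in> carrier_vec n" "w \<noteq> 0\<^sub>v n" "B *\<^sub>v w = z \<cdot>\<^sub>v w"
    using eigenvalue_root_char_poly[OF B] B by (auto simp: eigenvalue_def eigenvector_def)
  have Bw: "(\<Sum>j<n. of_real (A $$ (i,j)) * w $ j) = z * w $ i" if "i < n" for i
    using arg_cong[OF w(3), of "\<lambda>u. u $ i"] that w(1) A
    by (simp add: B_def scalar_prod_def lessThan_atLeast0)
  have symA: "A $$ (i,j) = A $$ (j,i)" if "i < n" "j < n" for i j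
    using arg_cong[OF sym, of "\<lambda>M. M $$ (i,j)"] that A by simp
  have wnz: "\<exists>i<n. w $ i \<noteq> 0"
    using w(1,2) by (metis eq_vecI carrier_vecD index_zero_vec)
  have "z \<in> \<real>"
    by (rule eigenvalue_of_real_symmetric_is_real[of n "\<lambda>i j. A $$ (i,j)" "\<lambda>i. w $ i"])
      (use symA Bw wnz in auto)
  then obtain e where z: "z = of_real e" by (auto elim: Reals_cases)
  obtain f :: "nat \<Rightarrow> real" where f: "\<And>i. i < n \<Longrightarrow> (\<Sum>j<n. A $$ (i,j) * f j) = e * f i" "\<exists>i<n. f i \<noteq> 0"
  proof (cases "\<exists>i<n. Re (w $ i) \<noteq> 0")
    case True
    show ?thesis
    proof (rule that[of "\<lambda>i. Re (w $ i)"])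
      show "(\<Sum>j<n. A $$ (i,j) * Re (w $ j)) = e * Re (w $ i)" if "i < n" for i
        using arg_cong[OF Bw[OF that], of Re] by (simp add: z)
    qed (fact True)
  next
    case False
    show ?thesis
    proof (rule that[of "\<lambda>i. Im (w $ i)"])
      show "(\<Sum>j<n. A $$ (i,j) * Im (w $ j)) = e * Im (w $ i)" if "i < n" for i
        using arg_cong[OF Bw[OF that], of Im] by (simp add: z)
      show "\<exists>i<n. Im (w $ i) \<noteq> 0" using False wnz by (auto simp: complex_eq_iff)
    qed
  qed
  define s where "s = (\<Sum>i<n. (f i)\<^sup>2)"
  obtain i0 where i0: "i0 < n" "f i0 \<noteq> 0" using f(2) by blast
  have "0 < s" unfolding s_def
    by (rule sum_pos2[of _ i0]) (use i0 in auto)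
  define v where "v = vec n (\<lambda>i. f i / sqrt s)"
  have "A *\<^sub>v v = e \<cdot>\<^sub>v v"
  proof (rule eq_vecI)
    fix i assume "i < dim_vec (e \<cdot>\<^sub>v v)"
    then have i: "i < n" by (simp add: v_def)
    have "(A *\<^sub>v v) $ i = (\<Sum>j<n. A $$ (i,j) * f j) / sqrt s"
      using i A by (simp add: v_def scalar_prod_def lessThan_atLeast0 sum_divide_distrib)
    then show "(A *\<^sub>v v) $ i = (e \<cdot>\<^sub>v v) $ i" using i f(1) by (simp add: v_def)
  qed (use A in \<open>simp add: v_def\<close>)
  moreover have "(\<Sum>i<n. (v $ i)\<^sup>2) = 1"
    using \<open>0 < s\<close> by (simp add: v_def power_divide s_def sum_divide_distrib[symmetric])
  moreover have "v \<in> carrier_vec n" by (simp add: v_def)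
  ultimately show ?thesis by blast
qed

text \<open>
  The Householder reflection that exchanges the unit vector \<open>v\<close> and the first basis vector \<open>e\<close>: with
  \<open>w = v - e\<close>, it is the identity minus \<open>2 / \<parallel>w\<parallel>\<^sup>2\<close> times \<open>w w\<^sup>T\<close>, where
  \<open>\<parallel>w\<parallel>\<^sup>2 = 2 * (1 - v\<^sub>0)\<close>. It is undefined for \<open>v = e\<close>, where the identity serves instead.
\<close>

lemma orthogonal_matrix_with_first_column:
  fixes v :: "real vec"
  assumes v: "v \<in> carrier_vec n" and unit: "(\<Sum>i<n. (v $ i)\<^sup>2) = 1" and n: "0 < n"
  shows "\<exists>W \<in> carrier_mat n n. transpose_mat W * W = 1\<^sub>m n \<and> col W 0 = v"
proof (cases "v = unit_vec n 0")
  case True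
  then show ?thesis
    using n by (intro bexI[of _ "1\<^sub>m n"]) simp_all
next
  case False
  define \<delta> :: "nat \<Rightarrow> nat \<Rightarrow> real" where "\<delta> i j = (if i = j then 1 else 0)" for i j
  define w where "w i = v $ i - \<delta> i 0" for i
  define c where "c = 1 - v $ 0"
  have split: "(\<Sum>i<n. g i) = g 0 + (\<Sum>i\<in>{..<n} - {0}. g i)" for g :: "nat \<Rightarrow> real"
    using n by (intro sum.remove) auto
  (* A unit vector with first coordinate 1 is the first basis vector. *)
  have "c \<noteq> 0"
  proof
    assume "c = 0"
    then have v0: "v $ 0 = 1" by (simp add: c_def)
    have "(\<Sum>i\<in>{..<n} - {0}. (v $ i)\<^sup>2) = 0" using unit v0 split[of "\<lambda>i. (v $ i)\<^sup>2"] by simp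
    then have "\<forall>i\<in>{..<n} - {0}. v $ i = 0" by (subst (asm) sum_nonneg_eq_0_iff) auto
    then have "v = unit_vec n 0"
      using v v0 by (intro eq_vecI) (auto simp: unit_vec_def)
    with False show False by simp
  qed
  have ww: "(\<Sum>k<n. w k * w k) = 2 * c"
  proof -
    have "(\<Sum>k<n. w k * w k) = (\<Sum>k<n. (v $ k)\<^sup>2 - 2 * (v $ k * \<delta> k 0) + \<delta> k 0)"
      by (intro sum.cong refl) (simp add: w_def \<delta>_def power2_eq_square algebra_simps)
    also have "\<dots> = 1 - 2 * v $ 0 + 1"
      using n by (simp add: sum.distrib sum_subtractf unit sum_distrib_left[symmetric])
        (simp add: \<delta>_def if_distrib[of "\<lambda>t. _ * t"] cong: if_cong)
    finally show ?thesis by (simp add: c_def)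
  qed
  define W where "W = mat n n (\<lambda>(i,j). \<delta> i j - w i * w j / c)"
  have W: "W \<in> carrier_mat n n" by (simp add: W_def)
  have "transpose_mat W * W = 1\<^sub>m n"
  proof (rule eq_matI)
    fix i j assume "i < dim_row (1\<^sub>m n)" "j < dim_col (1\<^sub>m n)"
    then have i: "i < n" and j: "j < n" by auto
    have "(transpose_mat W * W) $$ (i,j) = (\<Sum>k<n. (\<delta> k i - w k * w i / c) * (\<delta> k j - w k * w j / c))"
      using i j by (simp add: W_def scalar_prod_def lessThan_atLeast0)
    also have "\<dots> = (\<Sum>k<n. \<delta> k i * \<delta> k j - \<delta> k i * w k * (w j / c) - \<delta> k j * w k * (w i / c)
                      + w k * w k * (w i * w j / c\<^sup>2))"
      using \<open>c \<noteq> 0\<close> by (intro sum.cong refl) (simp add: field_simps power2_eq_square)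
    also have "\<dots> = \<delta> i j - w i * (w j / c) - w j * (w i / c) + 2 * c * (w i * w j / c\<^sup>2)"
      using i j by (simp only: sum.distrib sum_subtractf sum_distrib_right[symmetric] ww)
        (simp add: \<delta>_def if_distrib[of "\<lambda>t. t * _"] cong: if_cong)
    also have "\<dots> = \<delta> i j"
      using \<open>c \<noteq> 0\<close> by (simp add: field_simps power2_eq_square)
    finally show "(transpose_mat W * W) $$ (i,j) = 1\<^sub>m n $$ (i,j)" using i j by (simp add: \<delta>_def)
  qed (simp_all add: W_def)
  moreover have "col W 0 = v"
  proof (rule eq_vecI)
    fix i assume "i < dim_vec v"
    then have i: "i < n" using v by simp
    have "w 0 / c = -1" using \<open>c \<noteq> 0\<close> by (simp add: w_def c_def \<delta>_def field_simps)
    then have "w i * w 0 / c = - w i"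
      by (metis mult_minus1_right times_divide_eq_right)
    then show "col W 0 $ i = v $ i" using i n by (simp add: W_def w_def)
  qed (use v in \<open>simp add: W_def\<close>)
  ultimately show ?thesis using W by blast
qed

text \<open>
  Conjugating with an orthogonal matrix whose first column is an eigenvector clears the first column
  of the matrix below the diagonal, by symmetry also its first row, and leaves a symmetric block to which the
  induction hypothesis applies.
\<close>

theorem real_symmetric_diagonalizable:
  fixes A :: "real mat"
  assumes "A \<in> carrier_mat n n" and "transpose_mat A = A"
  shows "\<exists>U \<in> carrier_mat n n. \<exists>D \<in> carrier_mat n n.
    transpose_mat U * U = 1\<^sub>m n \<and> diagonal_mat D \<and> A = U * D * transpose_mat U"
  using assms
proof (induction n arbitrary: A)
  case 0
  then show ?case
    by (intro bexI[of _ "1\<^sub>m 0"] bexI[of _ A]) (auto simp: diagonal_mat_def)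
next
  case (Suc n)
  note A = Suc.prems(1) and sym = Suc.prems(2)
  obtain v e where v: "v \<in> carrier_vec (Suc n)" and Av: "A *\<^sub>v v = e \<cdot>\<^sub>v v"
    and unit: "(\<Sum>i<Suc n. (v $ i)\<^sup>2) = 1"
    using real_symmetric_has_unit_eigenvector[OF A sym] by blast
  obtain W where W: "W \<in> carrier_mat (Suc n) (Suc n)"
    and WW: "transpose_mat W * W = 1\<^sub>m (Suc n)" and colW: "col W 0 = v"
    using orthogonal_matrix_with_first_column[OF v unit] by blast
  let ?Wt = "transpose_mat W"
  have Wt: "?Wt \<in> carrier_mat (Suc n) (Suc n)" using W by simp
  have WW': "W * ?Wt = 1\<^sub>m (Suc n)" by (rule mat_mult_left_right_inverse[OF Wt W WW])
  define C where "C = ?Wt * (A * W)"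
  have C: "C \<in> carrier_mat (Suc n) (Suc n)" using A W Wt by (auto simp: C_def)
  have "transpose_mat C = transpose_mat (A * W) * W"
    unfolding C_def by (subst transpose_mult[OF Wt mult_carrier_mat[OF A W]]) simp
  also have "\<dots> = C"
    unfolding C_def by (simp add: transpose_mult[OF A W] sym assoc_mult_mat[OF Wt A W])
  finally have symC: "transpose_mat C = C" .
  have C0: "C $$ (i,0) = (if i = 0 then e else 0)" if "i < Suc n" for i
  proof -
    have "C $$ (i,0) = col W i \<bullet> col (A * W) 0" using that A W by (simp add: C_def)
    also have "col (A * W) 0 = e \<cdot>\<^sub>v v" by (subst col_mult2[OF A W]) (simp_all add: colW Av)
    also have "col W i \<bullet> (e \<cdot>\<^sub>v v) = e * (col W i \<bullet> col W 0)"
      using W v by (simp add: colW)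
    also have "col W i \<bullet> col W 0 = (?Wt * W) $$ (i,0)" using that W by simp
    finally show ?thesis using that by (simp add: WW)
  qed
  have C0': "C $$ (0,i) = (if i = 0 then e else 0)" if "i < Suc n" for i
    using arg_cong[OF symC, of "\<lambda>M. M $$ (i,0)"] C0[OF that] that C by simp
  define E where "E = mat 1 1 (\<lambda>_. e)"
  define A' where "A' = mat n n (\<lambda>(i,j). C $$ (Suc i, Suc j))"
  have E: "E \<in> carrier_mat 1 1" and A': "A' \<in> carrier_mat n n" by (simp_all add: E_def A'_def)
  let ?r = "0\<^sub>m 1 n" and ?c = "0\<^sub>m n 1"
  have Cblock: "C = four_block_mat E ?r ?c A'"
    by (rule eq_matI) (use C in \<open>auto simp: E_def A'_def C0 C0' less_Suc_eq_0_disj\<close>)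
  have "transpose_mat A' = A'"
  proof (rule eq_matI)
    fix i j assume "i < dim_row A'" "j < dim_col A'"
    then show "transpose_mat A' $$ (i,j) = A' $$ (i,j)"
      using arg_cong[OF symC, of "\<lambda>M. M $$ (Suc i, Suc j)"] C by (simp add: A'_def)
  qed (simp_all add: A'_def)
  from Suc.IH[OF A' this] obtain P D where P: "P \<in> carrier_mat n n" and D: "D \<in> carrier_mat n n"
    and PP: "transpose_mat P * P = 1\<^sub>m n" and diag: "diagonal_mat D"
    and A'eq: "A' = P * D * transpose_mat P" by blast
  let ?Q = "four_block_mat (1\<^sub>m 1) ?r ?c P" and ?G = "four_block_mat E ?r ?c D"
  let ?Qt = "four_block_mat (1\<^sub>m 1) ?r ?c (transpose_mat P)"
  have Q: "?Q \<in> carrier_mat (Suc n) (Suc n)" and G: "?G \<in> carrier_mat (Suc n) (Suc n)"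
    using P D E by auto
  have Pt: "transpose_mat P \<in> carrier_mat n n" using P by simp
  have Qt_eq: "transpose_mat ?Q = ?Qt"
    by (subst transpose_four_block_mat[of _ 1 1 _ n _ n]) (use P in simp_all)
  have QQ: "transpose_mat ?Q * ?Q = 1\<^sub>m (Suc n)"
    unfolding Qt_eq
    by (subst mult_four_block_mat[of _ 1 1 _ n _ n _ _ 1 _ n]) (use P PP in auto)
  have QG: "?Q * ?G = four_block_mat E ?r ?c (P * D)"
    by (subst mult_four_block_mat[of _ 1 1 _ n _ n _ _ 1 _ n]) (use P D E in auto)
  have "four_block_mat E ?r ?c (P * D) * ?Qt = C"
    unfolding Cblock A'eq
    by (subst mult_four_block_mat[of _ 1 1 _ n _ n _ _ 1 _ n]) (use P D E in auto)
  then have CQ: "C = ?Q * ?G * transpose_mat ?Q" by (simp only: QG Qt_eq)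
  have Qt: "transpose_mat ?Q \<in> carrier_mat (Suc n) (Suc n)" using Q by (simp only: transpose_carrier_mat)
  let ?U = "W * ?Q"
  have U: "?U \<in> carrier_mat (Suc n) (Suc n)" using W Q by auto
  have Ut: "transpose_mat ?U = transpose_mat ?Q * ?Wt" by (rule transpose_mult[OF W Q])
  have "transpose_mat ?U * ?U = transpose_mat ?Q * (?Wt * W * ?Q)"
    unfolding Ut by (simp only: assoc_mult_mat[OF Qt Wt U] assoc_mult_mat[OF Wt W Q])
  then have UU: "transpose_mat ?U * ?U = 1\<^sub>m (Suc n)" using Q by (simp only: WW left_mult_one_mat QQ)
  have CWt: "C * ?Wt \<in> carrier_mat (Suc n) (Suc n)" using C Wt by auto
  have "W * C * ?Wt = W * ?Wt * (A * (W * ?Wt))"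
    unfolding C_def
    by (simp add: assoc_mult_mat[of _ "Suc n" "Suc n" _ "Suc n" _ "Suc n"] W Wt A mult_carrier_mat[of _ _ "Suc n"])
  then have "A = W * C * ?Wt" using A by (simp add: WW')
  also have "\<dots> = ?U * ?G * transpose_mat ?U"
    unfolding CQ Ut
    by (simp only: assoc_mult_mat[of _ "Suc n" "Suc n" _ "Suc n" _ "Suc n"] W Wt Q Qt G mult_carrier_mat[of _ _ "Suc n"])
  finally have "A = ?U * ?G * transpose_mat ?U" .
  moreover have "diagonal_mat ?G"
  proof -
    have "D $$ (i,j) = 0" if "i < n" "j < n" "i \<noteq> j" for i j
      using diag D that by (simp add: diagonal_mat_def)
    then show ?thesis
      using D E by (simp add: diagonal_mat_def All_less_Suc2)
  qed
  ultimately show ?case using U G UU by blast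
qed

section \<open>Spectral decompositions and functions of a symmetric matrix\<close>

text \<open>
  The matrix \<open>\<phi>(A)\<close> of functional calculus: \<open>u i k\<close> is the \<open>i\<close>-th coordinate of the \<open>k\<close>-th
  orthonormal eigenvector, and \<open>\<phi> k\<close> is the new eigenvalue for it.
\<close>

definition spectral_filter ::
  "nat \<Rightarrow> (nat \<Rightarrow> real) \<Rightarrow> (nat \<Rightarrow> nat \<Rightarrow> real) \<Rightarrow> nat \<Rightarrow> nat \<Rightarrow> real" where
  "spectral_filter n \<phi> u i j = (\<Sum>k<n. \<phi> k * u i k * u j k)"

text \<open>
  Orthonormality of the columns of \<open>u\<close> implies that of the rows; both are recorded because the first
  reduces sums over coordinates and the second expands a vector in the eigenbasis.
\<close>

definition spectral_decomposition ::
  "nat \<Rightarrow> (nat \<Rightarrow> nat \<Rightarrow> real) \<Rightarrow> (nat \<Rightarrow> real) \<Rightarrow> (nat \<Rightarrow> nat \<Rightarrow> real) \<Rightarrow> bool" where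
  "spectral_decomposition n a d u \<longleftrightarrow>
     (\<forall>i<n. \<forall>j<n. a i j = spectral_filter n d u i j) \<and>
     (\<forall>k<n. \<forall>l<n. (\<Sum>i<n. u i k * u i l) = (if k = l then 1 else 0)) \<and>
     (\<forall>i<n. \<forall>j<n. (\<Sum>k<n. u i k * u j k) = (if i = j then 1 else 0))"

lemma spectral_filter_apply:
  "(\<Sum>j<n. spectral_filter n \<phi> u i j * y j) = (\<Sum>k<n. \<phi> k * u i k * (\<Sum>j<n. u j k * y j))"
  unfolding spectral_filter_def sum_distrib_right sum_distrib_left
  by (subst sum.swap) (simp add: mult.assoc)

text \<open>
  The squared Frobenius norm is invariant under orthogonal changes of basis: each column of \<open>u\<close> is an
  eigenvector of the filter (\<open>row\<close>), so each row of the filter has coordinates \<open>\<phi> k * u i k\<close> in that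
  basis, and the sum over \<open>i\<close> removes the \<open>u i k\<close>.
\<close>

lemma sum_squares_spectral_filter:
  assumes "spectral_decomposition n a d u"
  shows "(\<Sum>i<n. \<Sum>j<n. (spectral_filter n \<phi> u i j)\<^sup>2) = (\<Sum>k<n. (\<phi> k)\<^sup>2)"
proof -
  have orth: "(\<Sum>i<n. u i k * u i l) = (if k = l then 1 else 0)" if "k < n" "l < n" for k l
    using assms that by (simp add: spectral_decomposition_def)
  have row: "(\<Sum>j<n. spectral_filter n \<phi> u i j * u j k) = \<phi> k * u i k" if "k < n" for i k
  proof -
    have "(\<Sum>j<n. spectral_filter n \<phi> u i j * u j k) = (\<Sum>l<n. \<phi> l * u i l * (if l = k then 1 else 0))"
      unfolding spectral_filter_apply using that by (intro sum.cong refl) (simp add: orth)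
    also have "\<dots> = \<phi> k * u i k" using that by (simp add: if_distrib[of "\<lambda>t. _ * t"] cong: if_cong)
    finally show ?thesis .
  qed
  have "(\<Sum>j<n. (spectral_filter n \<phi> u i j)\<^sup>2) = (\<Sum>k<n. (\<phi> k)\<^sup>2 * (u i k * u i k))" for i
  proof -
    have "(\<Sum>j<n. (spectral_filter n \<phi> u i j)\<^sup>2)
        = (\<Sum>k<n. \<phi> k * u i k * (\<Sum>j<n. u j k * spectral_filter n \<phi> u i j))"
      unfolding power2_eq_square by (rule spectral_filter_apply)
    also have "\<dots> = (\<Sum>k<n. (\<phi> k)\<^sup>2 * (u i k * u i k))"
    proof (rule sum.cong[OF refl])
      fix k assume "k \<in> {..<n}"
      then have "(\<Sum>j<n. u j k * spectral_filter n \<phi> u i j) = \<phi> k * u i k"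
        using row[of k i] by (simp only: lessThan_iff mult.commute[of "u _ k"])
      then show "\<phi> k * u i k * (\<Sum>j<n. u j k * spectral_filter n \<phi> u i j) = (\<phi> k)\<^sup>2 * (u i k * u i k)"
        by (simp add: power2_eq_square)
    qed
    finally show ?thesis .
  qed
  then have "(\<Sum>i<n. \<Sum>j<n. (spectral_filter n \<phi> u i j)\<^sup>2) = (\<Sum>i<n. \<Sum>k<n. (\<phi> k)\<^sup>2 * (u i k * u i k))"
    by (simp only:)
  also have "\<dots> = (\<Sum>k<n. \<Sum>i<n. (\<phi> k)\<^sup>2 * (u i k * u i k))"
    by (rule sum.swap)
  also have "\<dots> = (\<Sum>k<n. (\<phi> k)\<^sup>2)"
    by (simp add: sum_distrib_left[symmetric] orth)
  finally show ?thesis .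
qed

text \<open>
  The eigenvalues occurring in the decomposition are the roots of the characteristic polynomial with
  their multiplicities, since similar matrices have the same characteristic polynomial.
\<close>

lemma symmetric_spectral_decomposition:
  fixes A :: "real mat"
  assumes A: "A \<in> carrier_mat n n" and sym: "transpose_mat A = A"
  shows "\<exists>d u. spectral_decomposition n (\<lambda>i j. A $$ (i,j)) d u \<and>
    proots (char_poly A) = mset (map d [0..<n])"
proof -
  obtain U D where U: "U \<in> carrier_mat n n" and D: "D \<in> carrier_mat n n"
    and UU: "transpose_mat U * U = 1\<^sub>m n" and diag: "diagonal_mat D"
    and A_eq: "A = U * D * transpose_mat U"
    using real_symmetric_diagonalizable[OF A sym] by blast
  have Ut: "transpose_mat U \<in> carrier_mat n n" using U by simp
  have UU': "U * transpose_mat U = 1\<^sub>m n" by (rule mat_mult_left_right_inverse[OF Ut U UU])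
  have UD: "(U * D) $$ (i,k) = D $$ (k,k) * U $$ (i,k)" if "i < n" "k < n" for i k
  proof -
    have "(U * D) $$ (i,k) = (\<Sum>l<n. U $$ (i,l) * D $$ (l,k))"
      using that U D by (simp add: scalar_prod_def lessThan_atLeast0)
    also have "\<dots> = (\<Sum>l<n. if l = k then D $$ (k,k) * U $$ (i,k) else 0)"
      using that D diag by (intro sum.cong refl) (auto simp: diagonal_mat_def)
    finally show ?thesis using that by simp
  qed
  have linear_factors: "proots (\<Prod>a\<leftarrow>as. [:- a, 1:]) = mset as" for as :: "real list"
  proof (induction as)
    case (Cons a as)
    have "(\<Prod>a\<leftarrow>as. [:- a, 1:]) \<noteq> 0" by (auto simp: prod_list_zero_iff)
    then have "proots ([:- a, 1:] * (\<Prod>a\<leftarrow>as. [:- a, 1:])) = {#a#} + mset as"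
      by (subst proots_mult) (simp_all add: Cons.IH)
    then show ?case by (simp del: mult_pCons_left)
  qed simp
  have "similar_mat_wit A D U (transpose_mat U)"
    by (rule similar_mat_witI[OF UU' UU A_eq A D U Ut])
  then have "char_poly A = char_poly D"
    by (intro char_poly_similar) (auto simp: similar_mat_def)
  also have "\<dots> = (\<Prod>a\<leftarrow>diag_mat D. [:- a, 1:])"
    using diag D by (intro char_poly_upper_triangular[OF D]) (auto simp: diagonal_mat_def)
  finally have "proots (char_poly A) = mset (diag_mat D)"
    by (simp only: linear_factors)
  then have roots: "proots (char_poly A) = mset (map (\<lambda>k. D $$ (k,k)) [0..<n])"
    using D by (simp add: diag_mat_def)
  have entries: "A $$ (i,j) = spectral_filter n (\<lambda>k. D $$ (k,k)) (\<lambda>i k. U $$ (i,k)) i j"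
    if "i < n" "j < n" for i j
  proof -
    define E where "E = U * D"
    have E: "E \<in> carrier_mat n n" using U D by (simp add: E_def)
    have "A $$ (i,j) = (\<Sum>k<n. E $$ (i,k) * U $$ (j,k))"
      unfolding A_eq E_def[symmetric]
      using that U E by (simp add: scalar_prod_def lessThan_atLeast0)
    then show ?thesis
      using that by (simp add: E_def UD spectral_filter_def del: index_mult_mat)
  qed
  have "(\<Sum>k<n. U $$ (i,k) * U $$ (j,k)) = (if i = j then 1 else 0)"
    and "(\<Sum>k<n. U $$ (k,i) * U $$ (k,j)) = (if i = j then 1 else 0)" if "i < n" "j < n" for i j
    using arg_cong[OF UU', of "\<lambda>M. M $$ (i,j)"] arg_cong[OF UU, of "\<lambda>M. M $$ (i,j)"] that U
    by (simp_all add: scalar_prod_def lessThan_atLeast0)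
  then have "spectral_decomposition n (\<lambda>i j. A $$ (i,j)) (\<lambda>k. D $$ (k,k)) (\<lambda>i k. U $$ (i,k))"
    unfolding spectral_decomposition_def by (intro conjI allI impI entries) assumption+
  with roots show ?thesis by blast
qed

text \<open>
  A diagonalisation produces the eigenvalues in some uncontrolled order, which is invisible to
  symmetric functions of them.
\<close>

lemma sum_over_ordered_eigenvalues:
  fixes F :: "real \<Rightarrow> real"
  assumes "proots (char_poly A) = mset (map d [0..<n])"
  shows "(\<Sum>i<n. F (ordered_eigenvalues A ! i)) = (\<Sum>k<n. F (d k))"
proof -
  let ?es = "ordered_eigenvalues A"
  have es: "mset ?es = mset (map d [0..<n])"
    using assms by (simp add: ordered_eigenvalues_def)
  have len: "length ?es = n" using arg_cong[OF es, of size] by simp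
  have "(\<Sum>i<n. F (?es ! i)) = sum_list (map F ?es)"
    by (simp add: sum_list_sum_nth len lessThan_atLeast0)
  also have "\<dots> = sum_mset (image_mset F (mset ?es))"
    by (metis mset_map sum_mset_sum_list)
  also have "\<dots> = sum_mset (mset (map (\<lambda>k. F (d k)) [0..<n]))"
    by (simp add: es image_mset.compositionality comp_def)
  also have "\<dots> = sum_list (map (\<lambda>k. F (d k)) [0..<n])"
    by (rule sum_mset_sum_list)
  also have "\<dots> = (\<Sum>k<n. F (d k))"
    by (simp add: sum_list_sum_nth lessThan_atLeast0)
  finally show ?thesis .
qed

section \<open>Bias and variance\<close>

text \<open>
  Expanding the square leaves the constant and the diagonal terms: the linear terms vanish as the
  noise is centred, and the mixed products by independence.
\<close>

lemma (in prob_space) expectation_square_affine_noise: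
  fixes eps :: "nat \<Rightarrow> 'a \<Rightarrow> real"
  assumes indep: "indep_vars (\<lambda>_. borel) eps {..<n}"
    and int: "\<And>i. i < n \<Longrightarrow> integrable M (eps i)"
    and mean: "\<And>i. i < n \<Longrightarrow> expectation (eps i) = 0"
    and int2: "\<And>i. i < n \<Longrightarrow> integrable M (\<lambda>\<omega>. (eps i \<omega>)\<^sup>2)"
    and var: "\<And>i. i < n \<Longrightarrow> expectation (\<lambda>\<omega>. (eps i \<omega>)\<^sup>2) = \<sigma>\<^sup>2"
  shows "expectation (\<lambda>\<omega>. (b + (\<Sum>j<n. w j * eps j \<omega>))\<^sup>2) = b\<^sup>2 + \<sigma>\<^sup>2 * (\<Sum>j<n. (w j)\<^sup>2)"
proof -
  have first: "has_bochner_integral M (eps i) 0" if "i < n" for i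
    using has_bochner_integral_integrable[OF int[OF that]] mean[OF that] by simp
  have second: "has_bochner_integral M (\<lambda>\<omega>. eps i \<omega> * eps j \<omega>) (if i = j then \<sigma>\<^sup>2 else 0)"
    if ij: "i < n" "j < n" for i j
  proof (cases "i = j")
    case True
    then show ?thesis
      using has_bochner_integral_integrable[OF int2[OF ij(1)]] var[OF ij(1)]
      by (simp add: power2_eq_square)
  next
    case False
    have ind: "indep_vars (\<lambda>_. borel) eps {i, j}"
      using indep by (rule indep_vars_subset) (use ij in auto)
    have int': "integrable M (eps k)" if "k \<in> {i, j}" for k using that ij int by auto
    have "integrable M (\<lambda>\<omega>. \<Prod>k\<in>{i, j}. eps k \<omega>)"
      by (rule indep_vars_integrable[OF _ ind]) (use int' in auto)
    moreover have "expectation (\<lambda>\<omega>. \<Prod>k\<in>{i, j}. eps k \<omega>) = (\<Prod>k\<in>{i, j}. expectation (eps k))"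
      by (rule indep_vars_lebesgue_integral[OF _ ind]) (use int' in auto)
    ultimately show ?thesis
      using False ij mean by (simp add: has_bochner_integral_iff)
  qed
  have const: "has_bochner_integral M (\<lambda>\<omega>. b\<^sup>2) (b\<^sup>2)"
    by (simp add: has_bochner_integral_iff prob_space)
  have "has_bochner_integral M
      (\<lambda>\<omega>. b\<^sup>2 + (\<Sum>j<n. 2 * b * w j * eps j \<omega>) + (\<Sum>i<n. \<Sum>j<n. w i * w j * (eps i \<omega> * eps j \<omega>)))
      (b\<^sup>2 + (\<Sum>j<n. 2 * b * w j * 0) + (\<Sum>i<n. \<Sum>j<n. w i * w j * (if i = j then \<sigma>\<^sup>2 else 0)))"
    by (intro has_bochner_integral_add const has_bochner_integral_sum has_bochner_integral_mult_right
        first second) auto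
  moreover have "b\<^sup>2 + (\<Sum>j<n. 2 * b * w j * eps j \<omega>) + (\<Sum>i<n. \<Sum>j<n. w i * w j * (eps i \<omega> * eps j \<omega>))
      = (b + (\<Sum>j<n. w j * eps j \<omega>))\<^sup>2" for \<omega>
    by (simp add: power2_sum power2_eq_square[of "sum _ _"] sum_product sum_distrib_left mult_ac)
  moreover have "b\<^sup>2 + (\<Sum>j<n. 2 * b * w j * 0) + (\<Sum>i<n. \<Sum>j<n. w i * w j * (if i = j then \<sigma>\<^sup>2 else 0))
      = b\<^sup>2 + \<sigma>\<^sup>2 * (\<Sum>j<n. (w j)\<^sup>2)"
    by (simp add: sum_distrib_left power2_eq_square[of "w _"] mult_ac if_distrib[of "\<lambda>t. _ * t"] cong: if_cong)
  ultimately show ?thesis by (simp add: has_bochner_integral_integral_eq)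
qed

section \<open>Kernel ridge regression as a linear smoother\<close>

lemma ip_norm_square:
  assumes "function_space_on D H" and "inner_product_on H ip" and "f \<in> H"
  shows "(ip_norm ip f)\<^sup>2 = ip f f" and "0 \<le> ip f f" and "ip f f = 0 \<Longrightarrow> f = (\<lambda>t. 0)"
proof -
  have pos: "f \<noteq> (\<lambda>t. 0) \<Longrightarrow> 0 < ip f f" using assms by (simp add: inner_product_on_def)
  have "ip (\<lambda>t. 0 * f t) f = 0 * ip f f" using assms unfolding inner_product_on_def by blast
  then have zero: "f = (\<lambda>t. 0) \<Longrightarrow> ip f f = 0" by simp
  show ge: "0 \<le> ip f f" using pos zero by (cases "f = (\<lambda>t. 0)") (auto simp: less_imp_le)
  then show "(ip_norm ip f)\<^sup>2 = ip f f" by (simp add: ip_norm_def)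
  show "ip f f = 0 \<Longrightarrow> f = (\<lambda>t. 0)" using pos by force
qed

lemma function_space_diff:
  assumes fs: "function_space_on D H" and "f \<in> H" and g: "g \<in> H"
  shows "(\<lambda>t. f t - g t) \<in> H"
proof -
  have "(\<lambda>t. c * g t) \<in> H" for c using fs g by (simp add: function_space_on_def)
  from this[of "-1"] have "(\<lambda>t. - g t) \<in> H" by simp
  moreover have "(\<lambda>t. f t + h t) \<in> H" if "h \<in> H" for h
    using assms that by (simp add: function_space_on_def)
  ultimately have "(\<lambda>t. f t + - g t) \<in> H" by blast
  then show ?thesis by simp
qed

text \<open>
  By the reproducing property, the inner product with a combination of kernel sections depends only
  on the values at the corresponding points.
\<close>

lemma rkhs_kernel_combination:
  fixes m :: nat
  assumes rkhs: "is_rkhs D K H ip" and x: "x ` {..<m} \<subseteq> D"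
  shows "(\<lambda>t. \<Sum>i<m. c i * kernel_section D K (x i) t) \<in> H"
    and "f \<in> H \<Longrightarrow> ip (\<lambda>t. \<Sum>i<m. c i * kernel_section D K (x i) t) f = (\<Sum>i<m. c i * f (x i))"
proof -
  have fs: "function_space_on D H" and ip: "inner_product_on H ip"
    and sec: "\<And>s. s \<in> D \<Longrightarrow> kernel_section D K s \<in> H"
    and rep: "\<And>f s. f \<in> H \<Longrightarrow> s \<in> D \<Longrightarrow> ip f (kernel_section D K s) = f s"
    using rkhs by (auto simp: is_rkhs_def)
  have add: "(\<lambda>t. g t + h t) \<in> H" if "g \<in> H" "h \<in> H" for g h
    using fs that by (simp add: function_space_on_def)
  have scale: "(\<lambda>t. a * g t) \<in> H" if "g \<in> H" for g a
    using fs that by (simp add: function_space_on_def)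
  have ip_add: "ip (\<lambda>t. g t + h t) f = ip g f + ip h f" if "g \<in> H" "h \<in> H" "f \<in> H" for f g h
    using ip that by (simp add: inner_product_on_def)
  have ip_scale: "ip (\<lambda>t. a * g t) f = a * ip g f" if "g \<in> H" "f \<in> H" for f g a
    using ip that by (simp add: inner_product_on_def)
  have ip_sym: "ip g f = ip f g" if "g \<in> H" "f \<in> H" for f g
    using ip that by (simp add: inner_product_on_def)
  have "(\<lambda>t. \<Sum>i<m. c i * kernel_section D K (x i) t) \<in> H \<and>
    (\<forall>f\<in>H. ip (\<lambda>t. \<Sum>i<m. c i * kernel_section D K (x i) t) f = (\<Sum>i<m. c i * f (x i)))"
    using x
  proof (induction m)
    case 0
    have "ip (\<lambda>t. 0) f = 0" if "f \<in> H" for f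
      using ip_scale[of "\<lambda>t. 0" f 0] fs that by (simp add: function_space_on_def)
    then show ?case using fs by (simp add: function_space_on_def)
  next
    case (Suc m)
    let ?S = "\<lambda>t. \<Sum>i<m. c i * kernel_section D K (x i) t" and ?k = "kernel_section D K (x m)"
    have S: "?S \<in> H" "\<And>f. f \<in> H \<Longrightarrow> ip ?S f = (\<Sum>i<m. c i * f (x i))"
      using Suc.IH Suc.prems by (auto simp: lessThan_Suc)
    have xm: "x m \<in> D" using Suc.prems by auto
    then have k: "?k \<in> H" by (rule sec)
    have "ip (\<lambda>t. ?S t + c m * ?k t) f = (\<Sum>i<m. c i * f (x i)) + c m * f (x m)" if f: "f \<in> H" for f
      using xm by (simp add: ip_add[OF S(1) scale[OF k] f] ip_scale[OF k f] S(2)[OF f]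
          ip_sym[OF k f] rep[OF f])
    then show ?case using add[OF S(1) scale[OF k]] by simp
  qed
  then show "(\<lambda>t. \<Sum>i<m. c i * kernel_section D K (x i) t) \<in> H"
    and "f \<in> H \<Longrightarrow> ip (\<lambda>t. \<Sum>i<m. c i * kernel_section D K (x i) t) f = (\<Sum>i<m. c i * f (x i))"
    by blast+
qed

text \<open>
  The hypothesis \<open>stat\<close> is the normal equation: it makes the gradient of the objective vanish
  at \<open>g\<close>. The linear terms in \<open>h = f - g\<close> then cancel, namely \<open>- 2 * \<lambda> * ip g h\<close> from the empirical
  error against \<open>2 * \<lambda> * ip g h\<close> from the penalty, and only the quadratic part remains. This holds
  against every competitor \<open>f\<close> in the space, so that the representer theorem is a consequence.
\<close>

lemma krr_objective_expansion:
  fixes c :: "nat \<Rightarrow> real"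
  assumes rkhs: "is_rkhs D K H ip" and x: "x ` {..<n} \<subseteq> D" and n: "n \<ge> 1"
    and g_def: "g = (\<lambda>t. \<Sum>j<n. c j * kernel_section D K (x j) t)"
    and stat: "\<forall>i<n. y i - g (x i) = real n * lam * c i"
    and f: "f \<in> H"
  shows "krr_objective ip n x lam y f = krr_objective ip n x lam y g
    + (\<Sum>i<n. (f (x i) - g (x i))\<^sup>2) / real n + lam * ip (\<lambda>t. f t - g t) (\<lambda>t. f t - g t)"
proof -
  have fs: "function_space_on D H" and ip: "inner_product_on H ip"
    using rkhs by (auto simp: is_rkhs_def)
  have g: "g \<in> H" unfolding g_def by (rule rkhs_kernel_combination(1)[OF rkhs x])
  define h where "h = (\<lambda>t. f t - g t)"
  have h: "h \<in> H" unfolding h_def by (rule function_space_diff[OF fs f g])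
  have ip_add: "ip (\<lambda>t. a t + b t) k = ip a k + ip b k" if "a \<in> H" "b \<in> H" "k \<in> H" for a b k
    using ip that by (simp add: inner_product_on_def)
  have ip_sym: "ip a b = ip b a" if "a \<in> H" "b \<in> H" for a b
    using ip that by (simp add: inner_product_on_def)
  have fgh: "f = (\<lambda>t. g t + h t)" by (simp add: h_def)
  have "ip f f = ip g f + ip h f" using ip_add[OF g h f] by (simp add: fgh[symmetric])
  also have "ip g f = ip g g + ip g h"
    using ip_add[OF g h g] ip_sym[OF f g] ip_sym[OF h g] by (simp add: fgh[symmetric])
  also have "ip h f = ip g h + ip h h"
    using ip_add[OF g h h] ip_sym[OF f h] by (simp add: fgh[symmetric])
  finally have ff: "ip f f = ip g g + 2 * ip g h + ip h h" by simp
  have gh: "ip g h = (\<Sum>i<n. c i * h (x i))"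
    unfolding g_def by (rule rkhs_kernel_combination(2)[OF rkhs x h])
  have "(\<Sum>i<n. (y i - f (x i))\<^sup>2)
      = (\<Sum>i<n. (y i - g (x i))\<^sup>2 - 2 * real n * lam * (c i * h (x i)) + (h (x i))\<^sup>2)"
  proof (rule sum.cong[OF refl])
    fix i assume "i \<in> {..<n}"
    then have *: "y i - f (x i) = real n * lam * c i - h (x i)" "y i - g (x i) = real n * lam * c i"
      using stat[rule_format, of i] by (simp_all add: h_def)
    show "(y i - f (x i))\<^sup>2 = (y i - g (x i))\<^sup>2 - 2 * real n * lam * (c i * h (x i)) + (h (x i))\<^sup>2"
      unfolding * by (simp add: power2_eq_square algebra_simps)
  qed
  also have "\<dots> = (\<Sum>i<n. (y i - g (x i))\<^sup>2) - 2 * real n * lam * ip g h + (\<Sum>i<n. (h (x i))\<^sup>2)"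
    by (simp add: gh sum.distrib sum_subtractf sum_distrib_left)
  finally have "(\<Sum>i<n. (y i - f (x i))\<^sup>2) / real n
      = (\<Sum>i<n. (y i - g (x i))\<^sup>2) / real n - 2 * lam * ip g h + (\<Sum>i<n. (h (x i))\<^sup>2) / real n"
    using n by (simp add: field_simps)
  then have "krr_objective ip n x lam y f
      = krr_objective ip n x lam y g + (\<Sum>i<n. (h (x i))\<^sup>2) / real n + lam * ip h h"
    using ip_norm_square(1)[OF fs ip f] ip_norm_square(1)[OF fs ip g] ff
    by (simp add: krr_objective_def algebra_simps)
  then show "krr_objective ip n x lam y f = krr_objective ip n x lam y g
    + (\<Sum>i<n. (f (x i) - g (x i))\<^sup>2) / real n + lam * ip (\<lambda>t. f t - g t) (\<lambda>t. f t - g t)"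
    by (simp add: h_def)
qed

text \<open>
  The penalty makes the quadratic part positive definite, so a solution of the normal equation is the
  only minimiser and therefore the one that \<open>arg_min\<close> selects.
\<close>

lemma krr_eq_kernel_combination:
  fixes c :: "nat \<Rightarrow> real"
  assumes rkhs: "is_rkhs D K H ip" and x: "x ` {..<n} \<subseteq> D" and n: "n \<ge> 1" and lam: "lam > 0"
    and g_def: "g = (\<lambda>t. \<Sum>j<n. c j * kernel_section D K (x j) t)"
    and stat: "\<forall>i<n. y i - g (x i) = real n * lam * c i"
  shows "krr H ip n x lam y = g"
    and "f \<in> H \<Longrightarrow> krr_objective ip n x lam y g \<le> krr_objective ip n x lam y f"
proof -
  have fs: "function_space_on D H" and ip: "inner_product_on H ip"
    using rkhs by (auto simp: is_rkhs_def)
  have g: "g \<in> H" unfolding g_def by (rule rkhs_kernel_combination(1)[OF rkhs x])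
  let ?J = "krr_objective ip n x lam y"
  have diff: "(\<lambda>t. f t - g t) \<in> H" if "f \<in> H" for f
    by (rule function_space_diff[OF fs that g])
  have gap: "?J g + lam * ip (\<lambda>t. f t - g t) (\<lambda>t. f t - g t) \<le> ?J f" if "f \<in> H" for f
    unfolding krr_objective_expansion[OF rkhs x n g_def stat that] by (simp add: sum_nonneg)
  have nonneg: "0 \<le> lam * ip (\<lambda>t. f t - g t) (\<lambda>t. f t - g t)" if "f \<in> H" for f
    using ip_norm_square(2)[OF fs ip diff[OF that]] lam by simp
  show min: "?J g \<le> ?J f" if "f \<in> H" for f
    using gap[OF that] nonneg[OF that] by linarith
  have unique: "f = g" if f: "f \<in> H" and "?J f \<le> ?J g" for f
  proof -
    have "lam * ip (\<lambda>t. f t - g t) (\<lambda>t. f t - g t) = 0"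
      using gap[OF f] nonneg[OF f] that(2) by linarith
    then have "ip (\<lambda>t. f t - g t) (\<lambda>t. f t - g t) = 0" using lam by simp
    then have "(\<lambda>t. f t - g t) = (\<lambda>t. 0)" by (rule ip_norm_square(3)[OF fs ip diff[OF f]])
    then show ?thesis by (auto simp: fun_eq_iff)
  qed
  have "is_arg_min ?J (\<lambda>f. f \<in> H) g" using g min by (auto simp: is_arg_min_def not_less)
  then have "is_arg_min ?J (\<lambda>f. f \<in> H) (krr H ip n x lam y)"
    using someI[of "is_arg_min ?J (\<lambda>f. f \<in> H)" g] by (simp add: krr_def arg_min_def)
  then show "krr H ip n x lam y = g"
    using g by (intro unique) (auto simp: is_arg_min_def not_less)
qed

text \<open>
  In vector notation the normal equation for the coefficients is \<open>n * (A + \<lambda>) c = y\<close>. It is solved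
  in the eigenbasis, where \<open>p\<close> and \<open>r\<close> are the coordinates of \<open>y\<close> and of \<open>n * c\<close>; the fitted values
  \<open>n * A c\<close> then have the coordinates \<open>d k / (d k + \<lambda>) * p k\<close>.
\<close>

lemma krr_is_spectral_filter:
  assumes rkhs: "is_rkhs D K H ip" and x: "x ` {..<n} \<subseteq> D" and n: "n \<ge> 1" and lam: "lam > 0"
    and decomp: "spectral_decomposition n (\<lambda>i j. K (x i) (x j) / real n) d u"
    and d: "\<forall>k<n. 0 \<le> d k"
  shows "i < n \<Longrightarrow> krr H ip n x lam y (x i)
      = (\<Sum>j<n. spectral_filter n (\<lambda>k. d k / (d k + lam)) u i j * y j)"
    and "f \<in> H \<Longrightarrow>
      krr_objective ip n x lam y (krr H ip n x lam y) \<le> krr_objective ip n x lam y f"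
proof -
  have spec: "K (x i) (x j) / real n = spectral_filter n d u i j"
    and cols: "(\<Sum>k<n. u k i * u k j) = (if i = j then 1 else 0)"
    and rows: "(\<Sum>k<n. u i k * u j k) = (if i = j then 1 else 0)" if "i < n" "j < n" for i j
    using decomp that by (auto simp: spectral_decomposition_def)
  let ?F = "spectral_filter n"
  define p where "p k = (\<Sum>j<n. u j k * y j)" for k
  define r where "r k = p k / (d k + lam)" for k
  define c where "c j = (\<Sum>k<n. u j k * r k) / real n" for j
  define g where "g = (\<lambda>t. \<Sum>j<n. c j * kernel_section D K (x j) t)"
  have dlam: "d k + lam \<noteq> 0" if "k < n" for k using d[rule_format, OF that] lam by simp
  have coef: "(\<Sum>j<n. u j k * (\<Sum>l<n. u j l * r l)) = r k" if k: "k < n" for k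
  proof -
    have "(\<Sum>j<n. u j k * (\<Sum>l<n. u j l * r l)) = (\<Sum>l<n. \<Sum>j<n. r l * (u j k * u j l))"
      unfolding sum_distrib_left by (subst sum.swap) (simp add: mult_ac)
    also have "\<dots> = (\<Sum>l<n. if k = l then r l else 0)"
      using k by (intro sum.cong refl) (simp add: sum_distrib_left[symmetric] cols)
    finally show ?thesis using k by simp
  qed
  have gx: "g (x i) = (\<Sum>k<n. d k * u i k * r k)" if i: "i < n" for i
  proof -
    have "g (x i) = (\<Sum>j<n. K (x j) (x i) / real n * (\<Sum>k<n. u j k * r k))"
      using x i by (simp add: g_def c_def kernel_section_def image_subset_iff mult.commute)
    also have "\<dots> = (\<Sum>j<n. ?F d u i j * (\<Sum>k<n. u j k * r k))"
    proof (intro sum.cong refl)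
      fix j assume "j \<in> {..<n}"
      then have "K (x j) (x i) / real n = ?F d u i j"
        using i spec[of j i] by (simp add: spectral_filter_def mult_ac)
      then show "K (x j) (x i) / real n * (\<Sum>k<n. u j k * r k) = ?F d u i j * (\<Sum>k<n. u j k * r k)"
        by simp
    qed
    also have "\<dots> = (\<Sum>k<n. d k * u i k * r k)"
      unfolding spectral_filter_apply by (intro sum.cong refl) (simp add: coef)
    finally show ?thesis .
  qed
  have y: "y i = (\<Sum>k<n. u i k * p k)" if i: "i < n" for i
  proof -
    have "(\<Sum>k<n. u i k * p k) = (\<Sum>j<n. \<Sum>k<n. y j * (u i k * u j k))"
      unfolding p_def sum_distrib_left by (subst sum.swap) (simp add: mult_ac)
    also have "\<dots> = (\<Sum>j<n. if i = j then y j else 0)"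
      using i by (intro sum.cong refl) (simp add: sum_distrib_left[symmetric] rows)
    finally show ?thesis using i by simp
  qed
  have stat: "\<forall>i<n. y i - g (x i) = real n * lam * c i"
  proof (intro allI impI)
    fix i assume i: "i < n"
    have "y i - g (x i) = (\<Sum>k<n. u i k * p k - d k * u i k * r k)"
      by (simp only: y[OF i] gx[OF i] sum_subtractf)
    also have "\<dots> = (\<Sum>k<n. lam * (u i k * r k))"
      by (intro sum.cong refl) (use dlam in \<open>simp add: r_def field_simps\<close>)
    also have "\<dots> = real n * lam * c i"
      using n by (simp add: c_def sum_distrib_left[symmetric])
    finally show "y i - g (x i) = real n * lam * c i" .
  qed
  note krr = krr_eq_kernel_combination[OF rkhs x n lam g_def stat]
  have krr_g: "krr H ip n x lam y = g" by (rule krr(1))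
  show "krr H ip n x lam y (x i) = (\<Sum>j<n. ?F (\<lambda>k. d k / (d k + lam)) u i j * y j)" if "i < n"
    unfolding krr_g gx[OF that] spectral_filter_apply by (simp add: r_def p_def mult_ac)
  show "krr_objective ip n x lam y (krr H ip n x lam y) \<le> krr_objective ip n x lam y f" if "f \<in> H"
    unfolding krr_g by (rule krr(2)[OF that])
qed

text \<open>
  An eigenvalue is the value of the quadratic form at its unit eigenvector, hence nonnegative for a
  positive semi-definite kernel.
\<close>

lemma kernel_matrix_spectral_decomposition:
  assumes x: "x ` {..<n} \<subseteq> D" and sym: "kernel_symmetric D K" and psd: "kernel_psd D K"
  shows "\<exists>d u. spectral_decomposition n (\<lambda>i j. K (x i) (x j) / real n) d u \<and> (\<forall>k<n. 0 \<le> d k) \<and>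
    proots (char_poly (kernel_matrix n x K)) = mset (map d [0..<n])"
proof -
  let ?A = "kernel_matrix n x K"
  have A: "?A \<in> carrier_mat n n" by (simp add: kernel_matrix_def)
  have A_sym: "transpose_mat ?A = ?A"
    using sym x by (intro eq_matI) (auto simp: kernel_matrix_def kernel_symmetric_def image_subset_iff)
  obtain d u where "spectral_decomposition n (\<lambda>i j. ?A $$ (i,j)) d u"
    and roots: "proots (char_poly ?A) = mset (map d [0..<n])"
    using symmetric_spectral_decomposition[OF A A_sym] by blast
  then have decomp: "spectral_decomposition n (\<lambda>i j. K (x i) (x j) / real n) d u"
    by (simp add: spectral_decomposition_def kernel_matrix_def)
  have spec: "K (x i) (x j) / real n = spectral_filter n d u i j"
    and cols: "(\<Sum>k<n. u k i * u k j) = (if i = j then 1 else 0)" if "i < n" "j < n" for i j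
    using decomp that by (auto simp: spectral_decomposition_def)
  have d: "\<forall>k<n. 0 \<le> d k"
  proof (intro allI impI)
    fix k assume k: "k < n"
    have "(\<Sum>j<n. K (x i) (x j) / real n * u j k) = d k * u i k" if i: "i < n" for i
    proof -
      have "(\<Sum>j<n. K (x i) (x j) / real n * u j k) = (\<Sum>j<n. spectral_filter n d u i j * u j k)"
        using i by (intro sum.cong refl) (simp add: spec)
      also have "\<dots> = (\<Sum>l<n. if k = l then d l * u i l else 0)"
        unfolding spectral_filter_apply using k by (intro sum.cong refl) (simp add: cols)
      finally show ?thesis using k by simp
    qed
    then have "(\<Sum>i<n. u i k * (\<Sum>j<n. K (x i) (x j) / real n * u j k)) = (\<Sum>i<n. d k * (u i k * u i k))"
      by (intro sum.cong refl) simp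
    also have "\<dots> = d k" using k by (simp add: sum_distrib_left[symmetric] cols)
    finally have "d k = (\<Sum>i<n. \<Sum>j<n. u i k * u j k * K (x i) (x j)) / real n"
      by (simp add: sum_distrib_left sum_divide_distrib mult_ac)
    also have "0 \<le> \<dots>"
      using psd x by (intro divide_nonneg_nonneg) (auto simp: kernel_psd_def image_subset_iff)
    finally show "0 \<le> d k" .
  qed
  with decomp roots show ?thesis by blast
qed

section \<open>The risk bound\<close>

theorem theorem1:
  fixes D :: "(real ^ 'd) set"
    and K :: "real ^ 'd \<Rightarrow> real ^ 'd \<Rightarrow> real"
    and H :: "(real ^ 'd \<Rightarrow> real) set"
    and ip :: "(real ^ 'd \<Rightarrow> real) \<Rightarrow> (real ^ 'd \<Rightarrow> real) \<Rightarrow> real"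
    and n :: nat
    and x :: "nat \<Rightarrow> real ^ 'd"
    and fstar :: "real ^ 'd \<Rightarrow> real"
    and M :: "'w measure"
    and eps Y :: "nat \<Rightarrow> 'w \<Rightarrow> real"
    and \<sigma> lam :: real
    and \<mu> :: "nat \<Rightarrow> real"
    and gtilde :: "'w \<Rightarrow> real ^ 'd \<Rightarrow> real"
  assumes "n \<ge> 1"
    and "\<And>i. i < n \<Longrightarrow> x i \<in> D"
    and "prob_space M"
    and "prob_space.indep_vars M (\<lambda>_. borel) eps {..<n}"
    and "\<And>i. i < n \<Longrightarrow> integrable M (eps i)"
    and "\<And>i. i < n \<Longrightarrow> (\<integral>\<omega>. eps i \<omega> \<partial>M) = 0"
    and "\<And>i. i < n \<Longrightarrow> integrable M (\<lambda>\<omega>. (eps i \<omega>)\<^sup>2)"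
    and "\<And>i. i < n \<Longrightarrow> (\<integral>\<omega>. (eps i \<omega>)\<^sup>2 \<partial>M) = \<sigma>\<^sup>2"
    and "\<And>i \<omega>. Y i \<omega> = fstar (x i) + eps i \<omega>"
    and "kernel_symmetric D K"
    and "kernel_psd D K"
    and "is_rkhs D K H ip"
    and "\<And>i. \<mu> i = ordered_eigenvalues (kernel_matrix n x K) ! i"
    and "lam > 0"
    and "\<And>\<omega>. gtilde \<omega> = krr H ip n x lam (\<lambda>i. Y i \<omega>)"
  shows "risk M n x (\<lambda>\<omega> t. gtilde \<omega> t - fstar t)
    \<le> (INF f\<in>H. risk M n x (\<lambda>\<omega> t. f t - fstar t) + lam * (ip_norm ip f)\<^sup>2)
       + \<sigma>\<^sup>2 / real n * (\<Sum>i<n. (\<mu> i / (\<mu> i + lam))\<^sup>2)"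
proof -
  note n = assms(1) and Y = assms(9) and rkhs = assms(12) and mu = assms(13)
    and lam = assms(14) and gtilde = assms(15)
  have x: "x ` {..<n} \<subseteq> D" using assms(2) by auto
  interpret prob_space M by fact
  obtain d u where decomp: "spectral_decomposition n (\<lambda>i j. K (x i) (x j) / real n) d u"
    and d: "\<forall>k<n. 0 \<le> d k"
    and roots: "proots (char_poly (kernel_matrix n x K)) = mset (map d [0..<n])"
    using kernel_matrix_spectral_decomposition[OF x assms(10,11)] by blast
  define B where "B = spectral_filter n (\<lambda>k. d k / (d k + lam)) u"
  (* b is the bias vector: the residual of the ridge fit to the noiseless data. *)
  define b where "b i = (\<Sum>j<n. B i j * fstar (x j)) - fstar (x i)" for i
  let ?f0 = "krr H ip n x lam (\<lambda>i. fstar (x i))"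
  note krr = krr_is_spectral_filter[OF rkhs x n lam decomp d, folded B_def]
  have "(\<integral>\<omega>. (gtilde \<omega> (x i) - fstar (x i))\<^sup>2 \<partial>M) = (b i)\<^sup>2 + \<sigma>\<^sup>2 * (\<Sum>j<n. (B i j)\<^sup>2)"
    if i: "i < n" for i
  proof -
    have "gtilde \<omega> (x i) - fstar (x i) = b i + (\<Sum>j<n. B i j * eps j \<omega>)" for \<omega>
      by (simp add: krr(1)[OF i] gtilde Y b_def distrib_left sum.distrib)
    moreover have "expectation (\<lambda>\<omega>. (b i + (\<Sum>j<n. B i j * eps j \<omega>))\<^sup>2)
        = (b i)\<^sup>2 + \<sigma>\<^sup>2 * (\<Sum>j<n. (B i j)\<^sup>2)"
      by (rule expectation_square_affine_noise[OF assms(4-8)])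
    ultimately show ?thesis by simp
  qed
  then have "risk M n x (\<lambda>\<omega> t. gtilde \<omega> t - fstar t)
      = (\<Sum>i<n. (b i)\<^sup>2) / real n + \<sigma>\<^sup>2 / real n * (\<Sum>i<n. \<Sum>j<n. (B i j)\<^sup>2)"
    by (simp add: risk_def sum.distrib sum_distrib_left[symmetric] add_divide_distrib)
  also have "(\<Sum>i<n. \<Sum>j<n. (B i j)\<^sup>2) = (\<Sum>i<n. (\<mu> i / (\<mu> i + lam))\<^sup>2)"
    using sum_over_ordered_eigenvalues[OF roots, of "\<lambda>m. (m / (m + lam))\<^sup>2"]
    by (simp add: B_def sum_squares_spectral_filter[OF decomp] mu)
  also have "(\<Sum>i<n. (b i)\<^sup>2) / real n
      \<le> (INF f\<in>H. risk M n x (\<lambda>\<omega> t. f t - fstar t) + lam * (ip_norm ip f)\<^sup>2)"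
  proof (rule cINF_greatest)
    show "H \<noteq> {}" using rkhs by (auto simp: is_rkhs_def function_space_on_def)
    fix f assume f: "f \<in> H"
    have "b i = ?f0 (x i) - fstar (x i)" if "i < n" for i
      by (simp add: krr(1)[OF that] b_def)
    then have "(\<Sum>i<n. (b i)\<^sup>2) / real n \<le> krr_objective ip n x lam (\<lambda>i. fstar (x i)) ?f0"
      using lam by (simp add: krr_objective_def power2_commute)
    also have "\<dots> \<le> krr_objective ip n x lam (\<lambda>i. fstar (x i)) f"
      by (rule krr(2)[OF f])
    also have "\<dots> = risk M n x (\<lambda>\<omega> t. f t - fstar t) + lam * (ip_norm ip f)\<^sup>2"
      by (simp add: krr_objective_def risk_def prob_space power2_commute)
    finally show "(\<Sum>i<n. (b i)\<^sup>2) / real n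
        \<le> risk M n x (\<lambda>\<omega> t. f t - fstar t) + lam * (ip_norm ip f)\<^sup>2" .
  qed
  finally show ?thesis by simp
qed

end
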